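(* Let $K$ be an algebraically closed field and let $\mathfrak{a}\subseteq K[X_1,\ldots,X_n]$ be a radical ideal with $\mathrm{V}_K(\mathfrak{a})$ finite. Then there exists $0\neq g(x):=g(x_1,\ldots,x_n)\in K[x_1,\ldots,x_n]=K[X_1,\ldots,X_n]/\mathfrak{a}$ such that $\mathrm{V}_K(\mathfrak{a})=\{a_1=(a_{1i}),\ldots,a_r=(a_{ri})\}$, where for each $j=1,\ldots,r$ the $i$-th coordinate $a_{ji}$ of $a_j$ is an eigenvalue of $\lambda_{x_i}$ with eigenvector $g(x)$, i.e. $x_i\,g(x)=\lambda_{x_i}(g(x))=a_{ji}\,g(x)$ for each $j=1,\ldots,r$ and for all $i=1,\ldots,n$.
   Context: For an ideal $\mathfrak{a}\subseteq K[X_1,\ldots,X_n]$, $\mathrm{V}_K(\mathfrak{a}):=\{a\in K^n\mid f(a)=0\text{ for all }f\in\mathfrak{a}\}$. Here $x_i$ denotes the residue class of $X_i$ in $K[x_1,\ldots,x_n]:=K[X_1,\ldots,X_n]/\mathfrak{a}$, and $\lambda_{x_i}$ is the $K$-linear operator $y\mapsto x_i\,y$ on the $K$-vector space $K[x_1,\ldots,x_n]$.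
   Formalization: The eigenvector g(x) may depend on the point: for each j there is a nonzero g_j(x) with x_i g_j(x) = a_{ji} g_j(x) for all i; a single g(x) for all j is impossible when r ≥ 2, and when V_K(a) is empty (r = 0) no nonzero g(x) exists and none is claimed. *)

theory Defs
  imports "HOL-Library.Poly_Mapping" "HOL-Algebra.Algebraic_Closure_Type"
begin

text \<open>The polynomial ring over \<open>'k\<close> in the variables \<open>X i\<close>, \<open>i :: 'n\<close>: finitely supported maps from
  exponent vectors to coefficients, with the convolution product of \<^theory>\<open>HOL-Library.Poly_Mapping\<close>.
  For a finite \<open>'n\<close> with \<open>n\<close> elements this is the polynomial ring in \<open>n\<close> variables, and
  \<open>'n \<Rightarrow> 'k\<close> is affine \<open>n\<close>-space.\<close>

type_synonym ('n, 'k) mpoly = "('n \<Rightarrow>\<^sub>0 nat) \<Rightarrow>\<^sub>0 'k"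

definition Var :: "'n \<Rightarrow> ('n, 'k::comm_ring_1) mpoly"
  where "Var i = Poly_Mapping.single (Poly_Mapping.single i 1) 1"

definition Cst :: "'k::comm_ring_1 \<Rightarrow> ('n, 'k) mpoly"
  where "Cst c = Poly_Mapping.single 0 c"

definition eval_mpoly :: "('n::finite \<Rightarrow> 'k::comm_ring_1) \<Rightarrow> ('n, 'k) mpoly \<Rightarrow> 'k"
  where "eval_mpoly a f =
    (\<Sum>m\<in>Poly_Mapping.keys f. Poly_Mapping.lookup f m * (\<Prod>i\<in>UNIV. a i ^ Poly_Mapping.lookup m i))"

definition zero_locus :: "('n::finite, 'k::comm_ring_1) mpoly set \<Rightarrow> ('n \<Rightarrow> 'k) set"
  where "zero_locus I = {a. \<forall>f\<in>I. eval_mpoly a f = 0}"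

abbreviation mpoly_ring :: "('n, 'k::comm_ring_1) mpoly ring"
  where "mpoly_ring \<equiv> ring_of_type_algebra"

definition ideal_radical :: "('a, 'b) ring_scheme \<Rightarrow> 'a set \<Rightarrow> 'a set"
  where "ideal_radical R I = {x \<in> carrier R. \<exists>m::nat. m > 0 \<and> x [^]\<^bsub>R\<^esub> m \<in> I}"

definition radical_ideal :: "'a set \<Rightarrow> ('a, 'b) ring_scheme \<Rightarrow> bool"
  where "radical_ideal I R \<longleftrightarrow> ideal I R \<and> ideal_radical R I = I"

text \<open>The residue class of a polynomial, and the quotient ring with its structure of algebra over the
  coefficients. The elements of the quotient are cosets, and its zero is the coset \<open>I\<close>.\<close>

definition residue :: "('n, 'k::comm_ring_1) mpoly set \<Rightarrow> ('n, 'k) mpoly \<Rightarrow> ('n, 'k) mpoly set"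
  where "residue I f = I +>\<^bsub>mpoly_ring\<^esub> f"

definition quot_alg :: "('n, 'k::comm_ring_1) mpoly set \<Rightarrow> ('k, ('n, 'k) mpoly set) module"
  where "quot_alg I = ring.extend (mpoly_ring Quot I)
    (module.fields (\<lambda>c y. residue I (Cst c) \<otimes>\<^bsub>mpoly_ring Quot I\<^esub> y))"

definition mult_op :: "('a, 'b) monoid_scheme \<Rightarrow> 'a \<Rightarrow> 'a \<Rightarrow> 'a"
  where "mult_op A x = (\<lambda>y. x \<otimes>\<^bsub>A\<^esub> y)"

definition eigenvector :: "('k, 'v, 'm) module_scheme \<Rightarrow> ('v \<Rightarrow> 'v) \<Rightarrow> 'v \<Rightarrow> 'k \<Rightarrow> bool"
  where "eigenvector M T v c \<longleftrightarrow> v \<in> carrier M \<and> v \<noteq> \<zero>\<^bsub>M\<^esub> \<and> T v = c \<odot>\<^bsub>M\<^esub> v"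

lemma quot_alg_simps [simp]:
  "carrier (quot_alg I) = carrier (mpoly_ring Quot I)"
  "monoid.mult (quot_alg I) = monoid.mult (mpoly_ring Quot I)"
  "monoid.one (quot_alg I) = monoid.one (mpoly_ring Quot I)"
  "ring.zero (quot_alg I) = ring.zero (mpoly_ring Quot I)"
  "ring.add (quot_alg I) = ring.add (mpoly_ring Quot I)"
  "module.smult (quot_alg I) = (\<lambda>c y. residue I (Cst c) \<otimes>\<^bsub>mpoly_ring Quot I\<^esub> y)"
  by (simp_all add: quot_alg_def ring.defs module.defs)

lemma algebra_quot_alg:
  fixes I :: "('n, 'k::comm_ring_1) mpoly set"
  assumes "ideal I mpoly_ring"
  shows "algebra (ring_of_type_algebra :: 'k ring) (quot_alg I)"
proof -
  interpret ideal I mpoly_ring by fact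
  interpret Q: cring "mpoly_ring Quot I"
    by (rule quotient_is_cring) (rule cring_from_type_algebra)
  interpret h: ring_hom_ring mpoly_ring "mpoly_ring Quot I" "residue I"
    using rcos_ring_hom_ring by (simp add: residue_def[abs_def])
  have car: "f \<in> carrier mpoly_ring" for f :: "('n, 'k) mpoly"
    by (simp add: ring_of_type_algebra_def)
  have ops: "\<one>\<^bsub>mpoly_ring\<^esub> = (Cst 1 :: ('n, 'k) mpoly)"
    "Cst (c + d) = Cst c \<oplus>\<^bsub>mpoly_ring\<^esub> (Cst d :: ('n, 'k) mpoly)"
    "Cst (c * d) = Cst c \<otimes>\<^bsub>mpoly_ring\<^esub> (Cst d :: ('n, 'k) mpoly)" for c d
    by (simp_all add: ring_of_type_algebra_def Cst_def single_add mult_single)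
  have res: "residue I f \<in> carrier (mpoly_ring Quot I)" for f
    using h.hom_closed car by blast
  have add: "residue I (Cst (c + d)) = residue I (Cst c) \<oplus>\<^bsub>mpoly_ring Quot I\<^esub> residue I (Cst d)" for c d
    by (simp add: ops car)
  have mul: "residue I (Cst (c * d)) = residue I (Cst c) \<otimes>\<^bsub>mpoly_ring Quot I\<^esub> residue I (Cst d)" for c d
    by (simp add: ops car)
  have one: "residue I (Cst 1) = \<one>\<^bsub>mpoly_ring Quot I\<^esub>"
    using h.hom_one ops(1) by metis
  have "cring (quot_alg I)"
  proof (rule cringI)
    show "abelian_group (quot_alg I)"
      by (rule abelian_groupI) (auto simp: Q.a_ac intro: Q.l_neg)
    show "comm_monoid (quot_alg I)"
      by (rule comm_monoidI) (auto simp: Q.m_ac)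
  qed (auto simp: Q.l_distr)
  then show ?thesis
    by (intro algebraI cring_from_type_algebra)
      (auto simp: res add mul one ring_of_type_algebra_def[where 'a='k] Q.l_distr Q.r_distr Q.m_assoc)
qed

end

theory Submission
  imports Defs
begin

text \<open>By the Nullstellensatz, a product \<open>g\<close> of linear forms \<open>X i - b i\<close>, one for each point \<open>b \<noteq> a\<close> of
  the finite locus and with \<open>b i \<noteq> a i\<close>, is not in the ideal, whereas every \<open>(X i - a i) * g\<close> is.
  For the Nullstellensatz itself, a polynomial without powers in the ideal avoids some prime ideal \<open>P\<close>
  above it. A zero of \<open>P\<close> at which the polynomial does not vanish is found one coordinate at a
  time: the condition \<open>s \<noteq> 0\<close> on a point over \<open>C[x]\<close> follows from a condition \<open>r \<noteq> 0\<close> on its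
  restriction to \<open>C\<close>, with \<open>r \<notin> P\<close> if \<open>s \<notin> P\<close>, until only the constants are left.\<close>

section \<open>Ideals and subrings of a type-class ring\<close>

text \<open>Ideals as plain sets over a type-class ring, so that \<open>poly\<close> and the usual
  arithmetic apply directly; \<open>class_ideal_if_ideal\<close> passes here from
  \<open>ideal\<close>.\<close>

locale class_ideal =
  fixes J :: "'a::comm_ring_1 set"
  assumes zero_mem: "0 \<in> J"
    and add_mem: "x \<in> J \<Longrightarrow> y \<in> J \<Longrightarrow> x + y \<in> J"
    and mult_mem: "x \<in> J \<Longrightarrow> x * y \<in> J"
begin

lemma mult_mem_left: "x \<in> J \<Longrightarrow> y * x \<in> J"
  using mult_mem[of x y] by (simp add: mult.commute)

lemma uminus_mem: "x \<in> J \<Longrightarrow> - x \<in> J"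
  using mult_mem[of x "-1"] by simp

lemma diff_mem: "x \<in> J \<Longrightarrow> y \<in> J \<Longrightarrow> x - y \<in> J"
  using add_mem[of x "- y"] uminus_mem by simp

lemma sum_mem: "(\<And>i. i \<in> A \<Longrightarrow> f i \<in> J) \<Longrightarrow> sum f A \<in> J"
  by (induction A rule: infinite_finite_induct) (auto simp: zero_mem add_mem)

lemma poly_mem: "(\<And>i. coeff p i \<in> J) \<Longrightarrow> poly p x \<in> J"
  by (simp add: poly_altdef sum_mem mult_mem)

end

locale class_prime_ideal = class_ideal +
  assumes one_notin: "1 \<notin> J"
    and prime_mem: "x * y \<in> J \<Longrightarrow> x \<in> J \<or> y \<in> J"
begin

lemma power_notin: "x \<notin> J \<Longrightarrow> x ^ n \<notin> J"
  by (induction n) (use one_notin prime_mem in auto)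

end

text \<open>Zorn's lemma yields an ideal \<open>M\<close> maximal among those that contain
  \<open>I\<close> and no power of \<open>f\<close>. It is prime: adjoining an element outside
  \<open>M\<close> brings in a power of \<open>f\<close>, and for two such elements with product in
  \<open>M\<close> the product of these powers would lie in \<open>M\<close>.\<close>

lemma exists_prime_ideal_avoiding_powers:
  fixes I :: "'a::comm_ring_1 set"
  assumes "class_ideal I" and "\<And>n. f ^ n \<notin> I"
  obtains P where "class_prime_ideal P" "I \<subseteq> P" "f \<notin> P"
proof -
  define F where "F = {J. class_ideal J \<and> I \<subseteq> J \<and> (\<forall>n. f ^ n \<notin> J)}"
  have "\<exists>M\<in>F. \<forall>U\<in>F. M \<subseteq> U \<longrightarrow> U = M"
  proof (rule subset_Zorn_nonempty)
    show "F \<noteq> {}" using assms by (auto simp: F_def)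
    fix \<C> assume ne: "\<C> \<noteq> {}" and ch: "subset.chain F \<C>"
    have mem: "class_ideal U" "I \<subseteq> U" "\<And>n. f ^ n \<notin> U" if "U \<in> \<C>" for U
      using ch that unfolding subset_chain_def F_def by auto
    have "class_ideal (\<Union>\<C>)"
    proof
      show "0 \<in> \<Union>\<C>" using ne class_ideal.zero_mem[OF mem(1)] by blast
      show "x * y \<in> \<Union>\<C>" if xU: "x \<in> \<Union>\<C>" for x y
      proof -
        obtain U where U: "x \<in> U" "U \<in> \<C>" using xU by blast
        then show ?thesis using class_ideal.mult_mem[OF mem(1)] by blast
      qed
      show "x + y \<in> \<Union>\<C>" if xy: "x \<in> \<Union>\<C>" "y \<in> \<Union>\<C>" for x y
      proof -
        obtain U W where UW: "x \<in> U" "y \<in> W" "U \<in> \<C>" "W \<in> \<C>" using xy by blast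
        then have "U \<subseteq> W \<or> W \<subseteq> U" using ch unfolding subset_chain_def by blast
        then obtain Z where "x \<in> Z" "y \<in> Z" "Z \<in> \<C>" using UW by blast
        then show ?thesis using class_ideal.add_mem[OF mem(1)] by blast
      qed
    qed
    moreover have "I \<subseteq> \<Union>\<C>" using ne mem(2) by blast
    ultimately show "\<Union>\<C> \<in> F" unfolding F_def using mem(3) by blast
  qed
  then obtain M where M: "M \<in> F" and max: "\<And>U. U \<in> F \<Longrightarrow> M \<subseteq> U \<Longrightarrow> U = M" by blast
  interpret M: class_ideal M using M by (simp add: F_def)
  have pw: "f ^ n \<notin> M" for n using M by (simp add: F_def)
  \<comment> \<open>The set \<open>U\<close> below is the ideal \<open>M + (a)\<close>. Without a
    power of \<open>f\<close> it would belong to \<open>F\<close>, and maximality would put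
    \<open>a\<close> into \<open>M\<close>.\<close>
  have meets: "\<exists>n u. f ^ n - a * u \<in> M" if "a \<notin> M" for a
  proof (rule ccontr)
    assume no: "\<nexists>n u. f ^ n - a * u \<in> M"
    define U where "U = {y. \<exists>u. y - a * u \<in> M}"
    have "class_ideal U"
    proof
      show "0 \<in> U" unfolding U_def using M.zero_mem by (auto intro: exI[of _ 0])
      show "x * y \<in> U" if x: "x \<in> U" for x y
      proof -
        obtain u where "x - a * u \<in> M" using x by (auto simp: U_def)
        then have "x * y - a * (u * y) \<in> M"
          using M.mult_mem[of "x - a * u" y] by (simp add: algebra_simps)
        then show ?thesis unfolding U_def by blast
      qed
      show "x + y \<in> U" if xy: "x \<in> U" "y \<in> U" for x y
      proof -
        obtain u v where "x - a * u \<in> M" "y - a * v \<in> M" using xy by (auto simp: U_def)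
        then have "(x + y) - a * (u + v) \<in> M"
          using M.add_mem[of "x - a * u" "y - a * v"] by (simp add: algebra_simps)
        then show ?thesis unfolding U_def by blast
      qed
    qed
    moreover have "M \<subseteq> U" by (auto simp: U_def intro: exI[of _ 0])
    moreover have "f ^ n \<notin> U" for n using no by (auto simp: U_def)
    ultimately have "U \<in> F" "M \<subseteq> U" using M unfolding F_def by blast+
    then have "U = M" by (rule max)
    moreover have "a \<in> U" using M.zero_mem by (auto simp: U_def intro: exI[of _ 1])
    ultimately show False using that by blast
  qed
  have "class_prime_ideal M"
  proof
    show "1 \<notin> M" using pw[of 0] by simp
    show "x \<in> M \<or> y \<in> M" if xy: "x * y \<in> M" for x y
    proof (rule ccontr)
      assume "\<not> (x \<in> M \<or> y \<in> M)"
      then obtain n u k v where m: "f ^ n - x * u \<in> M" "f ^ k - y * v \<in> M"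
        using meets by metis
      \<comment> \<open>Modulo \<open>M\<close>, \<open>f ^ n\<close> is \<open>x * u\<close> and
        \<open>f ^ k\<close> is \<open>y * v\<close>, so their product is a multiple of
        \<open>x * y\<close>.\<close>
      have "f ^ (n + k) = (f ^ n - x * u) * f ^ k + (f ^ k - y * v) * (x * u) + x * y * (u * v)"
        by (simp add: power_add algebra_simps)
      also have "\<dots> \<in> M" by (intro M.add_mem M.mult_mem m xy)
      finally show False using pw by blast
    qed
  qed
  then show thesis using that M pw[of 1] by (auto simp: F_def)
qed

section \<open>Subrings and pseudo-division over them\<close>

locale class_subring =
  fixes C :: "'a::comm_ring_1 set"
  assumes zero_mem: "0 \<in> C" and one_mem: "1 \<in> C"
    and add_mem: "x \<in> C \<Longrightarrow> y \<in> C \<Longrightarrow> x + y \<in> C"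
    and uminus_mem: "x \<in> C \<Longrightarrow> - x \<in> C"
    and mult_mem: "x \<in> C \<Longrightarrow> y \<in> C \<Longrightarrow> x * y \<in> C"
begin

text \<open>The ring \<open>C[T]\<close>. As \<open>C\<close> is a set and not a type, it is cut out
  of the polynomials over the whole ring.\<close>

definition polys :: "'a poly set"
  where "polys = {p. \<forall>i. coeff p i \<in> C}"

lemma polys_coeff: "p \<in> polys \<Longrightarrow> coeff p i \<in> C"
  by (simp add: polys_def)

lemma power_mem: "x \<in> C \<Longrightarrow> x ^ n \<in> C"
  by (induction n) (auto simp: one_mem mult_mem)

lemma sum_mem: "(\<And>i. i \<in> A \<Longrightarrow> f i \<in> C) \<Longrightarrow> sum f A \<in> C"
  by (induction A rule: infinite_finite_induct) (auto simp: zero_mem add_mem)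

lemma polys_zero: "0 \<in> polys"
  by (simp add: polys_def zero_mem)

lemma polys_pCons: "a \<in> C \<Longrightarrow> p \<in> polys \<Longrightarrow> pCons a p \<in> polys"
  by (auto simp: polys_def coeff_pCons split: nat.splits)

lemma polys_add: "p \<in> polys \<Longrightarrow> q \<in> polys \<Longrightarrow> p + q \<in> polys"
  by (auto simp: polys_def add_mem)

lemma polys_uminus: "p \<in> polys \<Longrightarrow> - p \<in> polys"
  by (auto simp: polys_def uminus_mem)

lemma polys_diff: "p \<in> polys \<Longrightarrow> q \<in> polys \<Longrightarrow> p - q \<in> polys"
  using polys_add[of p "- q"] polys_uminus by simp

lemma polys_mult: "p \<in> polys \<Longrightarrow> q \<in> polys \<Longrightarrow> p * q \<in> polys"
  by (auto simp: polys_def coeff_mult intro!: sum_mem mult_mem)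

lemma polys_smult: "a \<in> C \<Longrightarrow> p \<in> polys \<Longrightarrow> smult a p \<in> polys"
  by (auto simp: polys_def mult_mem)

lemma polys_monom: "a \<in> C \<Longrightarrow> monom a n \<in> polys"
  by (auto simp: polys_def zero_mem)

lemmas polys_intros = polys_zero polys_pCons polys_add polys_uminus polys_diff polys_mult
  polys_smult polys_monom power_mem polys_coeff one_mem

text \<open>Long division with a leading coefficient that need not be a unit: instead of dividing by
  it, \<open>p\<close> is multiplied by it before each subtraction. The bound on
  \<open>degree h\<close> later keeps a quotient below a minimal degree.\<close>

lemma pseudo_division:
  assumes "p \<in> polys" and q: "q \<in> polys" "degree q > 0"
  shows "\<exists>k h r. smult (lead_coeff q ^ k) p = q * h + r \<and> degree r < degree q \<and>
    degree h \<le> degree p - degree q \<and> h \<in> polys \<and> r \<in> polys"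
  using assms(1)
proof (induction "degree p" arbitrary: p rule: less_induct)
  case less
  show ?case
  proof (cases "degree p < degree q")
    case True
    then show ?thesis
      by (intro exI[of _ 0] exI[of _ p]) (auto simp: less.prems polys_zero)
  next
    case False
    define m where "m = lead_coeff q"
    define u where "u = monom (lead_coeff p) (degree p - degree q)"
    define p' where "p' = smult m p - q * u"
    have u: "u \<in> polys" unfolding u_def by (intro polys_intros less.prems)
    have p': "p' \<in> polys" unfolding p'_def m_def by (intro polys_intros less.prems u q)
    have du: "degree u \<le> degree p - degree q" by (simp add: u_def degree_monom_le)
    have "degree p' \<le> degree p"
      unfolding p'_def using False du degree_mult_le[of q u]
      by (intro degree_diff_le degree_smult_le) simp
    moreover have "coeff p' (degree p) = 0"
      using False by (simp add: p'_def u_def m_def mult.commute[of q] coeff_monom_mult)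
    \<comment> \<open>Equal degrees would force \<open>p' = 0\<close> and so
      \<open>degree p = 0\<close>, against \<open>degree p \<ge> degree q > 0\<close>.\<close>
    ultimately have dp': "degree p' < degree p"
      using False q(2) by (metis degree_0 gr0I leading_coeff_0_iff le_neq_implies_less not_less_iff_gr_or_eq)
    obtain k h r where khr: "smult (m ^ k) p' = q * h + r" "degree r < degree q"
      "degree h \<le> degree p' - degree q" "h \<in> polys" "r \<in> polys"
      using less.hyps[OF dp' p'] by (auto simp: m_def)
    have "smult (m ^ Suc k) p = smult (m ^ k) p' + q * smult (m ^ k) u"
      by (simp add: p'_def algebra_simps smult_diff_right)
    also have "\<dots> = q * (h + smult (m ^ k) u) + r"
      by (simp add: khr(1) algebra_simps)
    finally have "smult (m ^ Suc k) p = q * (h + smult (m ^ k) u) + r" .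
    moreover have "degree (h + smult (m ^ k) u) \<le> degree p - degree q"
      using khr(3) dp' du degree_smult_le[of "m ^ k" u] by (intro degree_add_le) auto
    moreover have "h + smult (m ^ k) u \<in> polys"
      unfolding m_def by (intro polys_intros khr u q)
    ultimately show ?thesis using khr(2,5) unfolding m_def by blast
  qed
qed

end

text \<open>Were the leading coefficient of a minimal \<open>q\<close> in \<open>J\<close>,
  \<open>drop\<close> would remove the leading term and leave a member of smaller degree that still
  has a coefficient outside \<open>J\<close>. Taking \<open>c\<close> among the coefficients of
  \<open>p\<close> keeps it in the subring \<open>C\<close> when this is applied.\<close>

lemma (in class_ideal) exists_min_degree_lead_notin:
  fixes S :: "'a poly set"
  assumes drop: "\<And>p c n. p \<in> S \<Longrightarrow> c \<in> J \<Longrightarrow> c \<in> range (coeff p) \<Longrightarrow> p - monom c n \<in> S"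
    and s: "s \<in> S" "coeff s i \<notin> J"
  obtains q where "q \<in> S" "lead_coeff q \<notin> J"
    "\<And>p i. p \<in> S \<Longrightarrow> degree p < degree q \<Longrightarrow> coeff p i \<in> J"
proof -
  let ?N = "\<lambda>p. p \<in> S \<and> (\<exists>i. coeff p i \<notin> J)"
  obtain q where q: "?N q" and min: "\<And>p. ?N p \<Longrightarrow> degree q \<le> degree p"
    using s ex_has_least_nat[of ?N s degree] by blast
  have "lead_coeff q \<notin> J"
  proof
    assume l: "lead_coeff q \<in> J"
    define p where "p = q - monom (lead_coeff q) (degree q)"
    obtain i where i: "coeff q i \<notin> J" using q by blast
    have "i \<noteq> degree q" using l i by auto
    moreover have "i \<le> degree q" using i zero_mem by (metis coeff_eq_0 not_le)
    ultimately have "degree q > 0" by simp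
    have "p \<in> S" unfolding p_def using q l by (intro drop) auto
    moreover have "coeff p i \<notin> J" using i \<open>i \<noteq> degree q\<close> by (simp add: p_def)
    moreover have "degree p < degree q"
    proof -
      have "degree p \<le> degree q"
        unfolding p_def by (intro degree_diff_le) (auto simp: degree_monom_le)
      moreover have "coeff p (degree q) = 0" by (simp add: p_def)
      ultimately show ?thesis using \<open>degree q > 0\<close>
        by (metis degree_0 leading_coeff_0_iff le_neq_implies_less)
    qed
    ultimately show False using min[of p] by auto
  qed
  then show thesis using that q min by (meson leD)
qed

section \<open>Ring homomorphisms and their action on coefficients\<close>

locale class_ring_hom =
  fixes \<phi> :: "'a::comm_ring_1 \<Rightarrow> 'b::comm_ring_1"
  assumes hom_add: "\<phi> (x + y) = \<phi> x + \<phi> y"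
    and hom_mult: "\<phi> (x * y) = \<phi> x * \<phi> y"
    and hom_one: "\<phi> 1 = 1"
begin

lemma hom_zero: "\<phi> 0 = 0"
  using hom_add[of 0 0] by simp

lemma hom_uminus: "\<phi> (- x) = - \<phi> x"
  using hom_add[of x "- x"] by (simp add: hom_zero add_eq_0_iff)

lemma hom_diff: "\<phi> (x - y) = \<phi> x - \<phi> y"
  using hom_add[of x "- y"] by (simp add: hom_uminus)

lemma hom_sum: "\<phi> (sum f A) = (\<Sum>i\<in>A. \<phi> (f i))"
  by (induction A rule: infinite_finite_induct) (auto simp: hom_zero hom_add)

lemma hom_prod: "\<phi> (prod f A) = (\<Prod>i\<in>A. \<phi> (f i))"
  by (induction A rule: infinite_finite_induct) (auto simp: hom_one hom_mult)

lemma hom_power: "\<phi> (x ^ n) = \<phi> x ^ n"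
  by (induction n) (auto simp: hom_one hom_mult)

lemma map_poly_hom_add: "map_poly \<phi> (p + q) = map_poly \<phi> p + map_poly \<phi> q"
  by (intro poly_eqI) (simp add: coeff_map_poly hom_zero hom_add)

lemma map_poly_hom_diff: "map_poly \<phi> (p - q) = map_poly \<phi> p - map_poly \<phi> q"
  by (intro poly_eqI) (simp add: coeff_map_poly hom_zero hom_diff)

lemma map_poly_hom_mult: "map_poly \<phi> (p * q) = map_poly \<phi> p * map_poly \<phi> q"
  by (intro poly_eqI) (simp add: coeff_map_poly coeff_mult hom_zero hom_sum hom_mult)

lemma map_poly_hom_smult: "map_poly \<phi> (smult c p) = smult (\<phi> c) (map_poly \<phi> p)"
  by (intro poly_eqI) (simp add: coeff_map_poly hom_zero hom_mult)

lemma map_poly_eq_0: "(\<And>i. \<phi> (coeff p i) = 0) \<Longrightarrow> map_poly \<phi> p = 0"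
  by (intro poly_eqI) (simp add: coeff_map_poly hom_zero)

lemma hom_poly: "\<phi> (poly p x) = poly (map_poly \<phi> p) (\<phi> x)"
  by (induction p) (simp_all add: hom_zero hom_add hom_mult map_poly_pCons)

end

section \<open>Extending a point by one coordinate\<close>

text \<open>A nonconstant \<open>p\<close> takes the value 1 at a root of
  \<open>p - 1\<close>.\<close>

lemma poly_nonzero_imp_nonroot:
  fixes p :: "'k::alg_closed_field poly"
  assumes "p \<noteq> 0"
  obtains t where "poly p t \<noteq> 0"
proof (cases "degree p = 0")
  case True
  then show thesis using assms that by (metis degree_0_id poly_const_conv leading_coeff_0_iff)
next
  case False
  then have "coeff (p - 1) (degree p) \<noteq> 0" by (auto simp: coeff_1)
  then have "degree p \<le> degree (p - 1)" by (rule le_degree)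
  with False have "degree (p - 1) > 0" by simp
  then obtain t where "poly (p - 1) t = 0" using alg_closed_imp_poly_has_root by blast
  then show thesis using that[of t] by simp
qed

text \<open>Here \<open>\<phi>\<close> is a point over \<open>C\<close>, and \<open>t\<close> is a
  new value for the coordinate \<open>x\<close>; it need not be \<open>\<phi> x\<close>. If
  \<open>x\<close> is transcendental over \<open>C\<close> modulo \<open>P\<close>, then
  \<open>r\<close> is a coefficient of \<open>s\<close>. Otherwise \<open>r\<close> is the leading
  coefficient of a minimal polynomial of \<open>x\<close> times an element of \<open>C\<close> that
  is a multiple of \<open>s(x)\<close> modulo \<open>P\<close>.\<close>

lemma (in class_subring) extend_hom:
  fixes x :: 'a and P :: "'a set"
  assumes P: "class_prime_ideal P" and s: "s \<in> polys" "poly s x \<notin> P"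
  obtains r where "r \<in> C" "r \<notin> P"
    "\<And>\<phi> :: 'a \<Rightarrow> 'k::alg_closed_field. class_ring_hom \<phi> \<Longrightarrow> \<forall>c\<in>C \<inter> P. \<phi> c = 0 \<Longrightarrow> \<phi> r \<noteq> 0 \<Longrightarrow>
      \<exists>t. (\<forall>p\<in>polys. poly p x \<in> P \<longrightarrow> poly (map_poly \<phi> p) t = 0) \<and> poly (map_poly \<phi> s) t \<noteq> 0"
proof -
  interpret P: class_prime_ideal P by fact
  define K where "K = {p \<in> polys. poly p x \<in> P}"
  show thesis
  proof (cases "\<forall>p\<in>K. \<forall>i. coeff p i \<in> P")
    \<comment> \<open>The transcendental case: \<open>\<phi>\<close> kills all coefficients of every
      relation in \<open>K\<close>, so \<open>t\<close> only has to avoid the roots of the image of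
      \<open>s\<close>.\<close>
    case True
    obtain i where i: "coeff s i \<notin> P" using s P.poly_mem by blast
    show thesis
    proof (rule that[of "coeff s i"])
      show "coeff s i \<in> C" using s by (intro polys_intros)
      fix \<phi> :: "'a \<Rightarrow> 'k"
      assume \<phi>: "class_ring_hom \<phi>" "\<forall>c\<in>C \<inter> P. \<phi> c = 0" "\<phi> (coeff s i) \<noteq> 0"
      interpret \<phi>: class_ring_hom \<phi> by fact
      have "map_poly \<phi> s \<noteq> 0" using \<phi>(3) by (metis coeff_0 coeff_map_poly \<phi>.hom_zero)
      then obtain t where "poly (map_poly \<phi> s) t \<noteq> 0" using poly_nonzero_imp_nonroot by blast
      moreover have "poly (map_poly \<phi> p) t = 0" if "p \<in> polys" "poly p x \<in> P" for p
      proof -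
        have "map_poly \<phi> p = 0"
          using that True \<phi>(2) polys_coeff by (intro \<phi>.map_poly_eq_0) (auto simp: K_def)
        then show ?thesis by simp
      qed
      ultimately show "\<exists>t. (\<forall>p\<in>polys. poly p x \<in> P \<longrightarrow> poly (map_poly \<phi> p) t = 0) \<and>
        poly (map_poly \<phi> s) t \<noteq> 0" by blast
    qed (fact i)
  next
    case False
    then obtain p i where "p \<in> K" "coeff p i \<notin> P" by blast
    \<comment> \<open>The algebraic case: \<open>f\<close> serves as a minimal polynomial of
      \<open>x\<close> modulo \<open>P\<close>, with a leading coefficient that need not be a
      unit.\<close>
    then obtain f where f: "f \<in> K" "lead_coeff f \<notin> P"
      and minf: "\<And>p i. p \<in> K \<Longrightarrow> degree p < degree f \<Longrightarrow> coeff p i \<in> P"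
    proof (rule P.exists_min_degree_lead_notin[rotated], goal_cases)
      case (2 p c n)
      then show ?case unfolding K_def
        by (auto simp: poly_monom intro!: polys_intros P.diff_mem P.mult_mem)
    qed blast
    have fC: "f \<in> polys" and fP: "poly f x \<in> P" using f by (auto simp: K_def)
    have df: "degree f > 0"
    proof (rule ccontr)
      assume "\<not> degree f > 0"
      then have "poly f x = lead_coeff f" by (metis degree_0_id gr0I poly_const_conv)
      then show False using f fP by simp
    qed
    define l where "l = lead_coeff f"
    have l: "l \<in> C" "l \<notin> P" using f fC by (auto simp: l_def polys_coeff)
    text \<open>The polynomials over \<open>C\<close> whose value at \<open>x\<close> lies in \<open>(s(x)) + P\<close>. One of least
      degree among those with a coefficient outside \<open>P\<close> is constant: \<open>s(x)\<close> is algebraic over \<open>C\<close> modulo \<open>P\<close>, so it divides a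
      nonzero element of \<open>C\<close>.\<close>
    define L where "L = {p \<in> polys. \<exists>u\<in>polys. poly p x - poly s x * poly u x \<in> P}"
    \<comment> \<open>Reducing \<open>s\<close> modulo \<open>f\<close> shows that the least degree
      in question is below \<open>degree f\<close>: \<open>e(x)\<close> is
      \<open>l ^ k * s(x)\<close> modulo \<open>P\<close>, so \<open>e\<close> is in
      \<open>L\<close>, and not all its coefficients are in \<open>P\<close> because neither
      \<open>l\<close> nor \<open>s(x)\<close> is.\<close>
    obtain k h e where e: "smult (l ^ k) s = f * h + e" "degree e < degree f" "h \<in> polys" "e \<in> polys"
      using pseudo_division[OF s(1) fC df] by (auto simp: l_def)
    have ex: "l ^ k * poly s x = poly f x * poly h x + poly e x"
      using arg_cong[OF e(1), of "\<lambda>p. poly p x"] by simp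
    have "poly e x - poly s x * poly [:l ^ k:] x = - (poly f x * poly h x)"
      using ex by (simp add: algebra_simps)
    also have "\<dots> \<in> P" by (intro P.uminus_mem P.mult_mem fP)
    finally have eL: "e \<in> L" unfolding L_def
      using e l by (auto intro!: bexI[of _ "[:l ^ k:]"] polys_intros)
    obtain i where i: "coeff e i \<notin> P"
    proof (rule ccontr)
      assume "\<not> thesis"
      then have "poly e x \<in> P" using that by (intro P.poly_mem) blast
      then have "l ^ k * poly s x \<in> P" unfolding ex by (intro P.add_mem P.mult_mem fP)
      then show False using P.prime_mem P.power_notin l s by blast
    qed
    obtain q where q: "q \<in> L" "lead_coeff q \<notin> P"
      and minq: "\<And>p i. p \<in> L \<Longrightarrow> degree p < degree q \<Longrightarrow> coeff p i \<in> P"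
    proof (rule P.exists_min_degree_lead_notin[OF _ eL i], goal_cases)
      case (1 p c n)
      then obtain u where u: "u \<in> polys" "poly p x - poly s x * poly u x \<in> P" "p \<in> polys"
        by (auto simp: L_def)
      have "poly (p - monom c n) x - poly s x * poly u x =
        (poly p x - poly s x * poly u x) - c * x ^ n" by (simp add: poly_monom)
      also have "\<dots> \<in> P" using 1 by (intro P.diff_mem[OF u(2)] P.mult_mem)
      finally show ?case unfolding L_def using u 1 by (auto intro!: polys_intros)
    qed blast
    define m where "m = lead_coeff q"
    obtain u where u: "u \<in> polys" "poly q x - poly s x * poly u x \<in> P" and qC: "q \<in> polys"
      using q by (auto simp: L_def)
    have m: "m \<in> C" "m \<notin> P" using q qC by (auto simp: m_def polys_coeff)
    have dq: "degree q < degree f" using minq[OF eL] i e(2) by (meson leI le_less_trans)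
    \<comment> \<open>Otherwise divide \<open>f\<close> by \<open>q\<close>. The remainder
      \<open>e\<close> is in \<open>L\<close>, so by minimality of \<open>q\<close> its coefficients
      are in \<open>P\<close>, and hence so is \<open>q(x) * h(x)\<close>. By minimality of
      \<open>f\<close>, \<open>q(x)\<close> is not in \<open>P\<close>; thus \<open>h\<close> is in
      \<open>K\<close> and has all its coefficients in \<open>P\<close>. Comparing coefficients at
      \<open>degree f\<close> puts \<open>m ^ k * l\<close> into \<open>P\<close>.\<close>
    have "degree q = 0"
    proof (rule ccontr)
      assume "degree q \<noteq> 0"
      then have dq0: "degree q > 0" by simp
      obtain k h e where e: "smult (m ^ k) f = q * h + e" "degree e < degree q"
        "degree h \<le> degree f - degree q" "h \<in> polys" "e \<in> polys"
        using pseudo_division[OF fC qC dq0] by (auto simp: m_def)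
      have ex: "m ^ k * poly f x = poly q x * poly h x + poly e x"
        using arg_cong[OF e(1), of "\<lambda>p. poly p x"] by simp
      have "poly e x - poly s x * poly (- (u * h)) x
          = poly f x * m ^ k - (poly q x - poly s x * poly u x) * poly h x"
        using ex by (simp add: algebra_simps)
      also have "\<dots> \<in> P" by (intro P.diff_mem P.mult_mem[OF fP] P.mult_mem[OF u(2)])
      finally have "e \<in> L" unfolding L_def
        using e u by (auto intro!: bexI[of _ "- (u * h)"] polys_intros)
      then have eP: "coeff e i \<in> P" for i using minq e(2) by blast
      have "poly q x * poly h x = poly f x * m ^ k - poly e x"
        using ex by (simp add: algebra_simps)
      also have "\<dots> \<in> P" by (intro P.diff_mem P.mult_mem fP P.poly_mem eP)
      finally have "poly q x \<in> P \<or> poly h x \<in> P" by (rule P.prime_mem)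
      moreover have "poly q x \<notin> P" using minf[of q "degree q"] dq qC q(2) by (auto simp: K_def)
      ultimately have "h \<in> K" using e by (auto simp: K_def)
      then have hP: "coeff h i \<in> P" for i using minf e(3) dq dq0 by simp
      have "coeff (q * h + e) (degree f) \<in> P"
        by (auto simp: coeff_mult intro!: P.add_mem P.sum_mem P.mult_mem_left hP eP)
      then have "m ^ k * l \<in> P" unfolding e(1)[symmetric] by (simp add: l_def)
      then show False using P.prime_mem P.power_notin l m by blast
    qed
    then have qm: "q = [:m:]" by (simp add: m_def degree_0_id)
    \<comment> \<open>That \<open>\<phi> l\<close> is nonzero preserves the degree of
      \<open>f\<close> and so provides a root \<open>t\<close>; that \<open>\<phi> m\<close> is
      nonzero keeps \<open>s\<close> from vanishing there.\<close>
    show thesis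
    proof (rule that[of "m * l"])
      show "m * l \<in> C" using m l by (intro mult_mem)
      show "m * l \<notin> P" using P.prime_mem m l by blast
      fix \<phi> :: "'a \<Rightarrow> 'k"
      assume \<phi>: "class_ring_hom \<phi>" "\<forall>c\<in>C \<inter> P. \<phi> c = 0" "\<phi> (m * l) \<noteq> 0"
      interpret \<phi>: class_ring_hom \<phi> by fact
      have nz: "\<phi> m \<noteq> 0" "\<phi> l \<noteq> 0" using \<phi>(3) by (auto simp: \<phi>.hom_mult)
      have "coeff (map_poly \<phi> f) (degree f) \<noteq> 0"
        using nz by (simp add: coeff_map_poly \<phi>.hom_zero l_def)
      then have "degree (map_poly \<phi> f) > 0" using df by (meson le_degree less_le_trans)
      then obtain t where t: "poly (map_poly \<phi> f) t = 0" using alg_closed_imp_poly_has_root by blast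
      \<comment> \<open>Pseudo-division by \<open>f\<close> leaves a remainder in \<open>K\<close>
        of degree below \<open>degree f\<close>. Its coefficients lie in
        \<open>C \<inter> P\<close>, so \<open>\<phi>\<close> kills it, and \<open>f\<close>
        vanishes at \<open>t\<close>.\<close>
      have vanish: "poly (map_poly \<phi> p) t = 0" if p: "p \<in> polys" "poly p x \<in> P" for p
      proof -
        obtain k h e where e: "smult (l ^ k) p = f * h + e" "degree e < degree f" "e \<in> polys"
          using pseudo_division[OF p(1) fC df] by (auto simp: l_def)
        have "poly e x = poly p x * l ^ k - poly f x * poly h x"
          using arg_cong[OF e(1), of "\<lambda>p. poly p x"] by (simp add: algebra_simps)
        also have "\<dots> \<in> P" by (intro P.diff_mem P.mult_mem p fP)
        finally have "e \<in> K" using e by (simp add: K_def)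
        then have "map_poly \<phi> e = 0"
          using minf e \<phi>(2) polys_coeff by (intro \<phi>.map_poly_eq_0) blast
        then have "smult (\<phi> l ^ k) (map_poly \<phi> p) = map_poly \<phi> f * map_poly \<phi> h"
          using arg_cong[OF e(1), of "map_poly \<phi>"]
          by (simp add: \<phi>.map_poly_hom_add \<phi>.map_poly_hom_mult \<phi>.map_poly_hom_smult \<phi>.hom_power)
        from arg_cong[OF this, of "\<lambda>p. poly p t"] show ?thesis using t nz by simp
      qed
      \<comment> \<open>The choice of \<open>u\<close> makes \<open>q - s * u\<close> a relation for
        \<open>x\<close> modulo \<open>P\<close>.\<close>
      have "poly (map_poly \<phi> (q - s * u)) t = 0"
        using u qC s by (intro vanish polys_intros) auto
      then have "\<phi> m = poly (map_poly \<phi> s) t * poly (map_poly \<phi> u) t"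
        by (simp add: qm \<phi>.map_poly_hom_diff \<phi>.map_poly_hom_mult map_poly_pCons \<phi>.hom_zero)
      then have "poly (map_poly \<phi> s) t \<noteq> 0" using nz by auto
      then show "\<exists>t. (\<forall>p\<in>polys. poly p x \<in> P \<longrightarrow> poly (map_poly \<phi> p) t = 0) \<and>
        poly (map_poly \<phi> s) t \<noteq> 0" using vanish by blast
    qed
  qed
qed

section \<open>Evaluation of polynomials\<close>

lemma poly_mapping_additive_induct [case_names zero single add]:
  assumes "Q 0" and "\<And>m c. Q (Poly_Mapping.single m c)" and "\<And>f g. Q f \<Longrightarrow> Q g \<Longrightarrow> Q (f + g)"
  shows "Q (f :: 'a \<Rightarrow>\<^sub>0 'b::comm_monoid_add)"
proof (induction f rule: update_induct)
  case (update f a b)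
  have "Poly_Mapping.update a b f = Poly_Mapping.single a b + f"
    using update(1)
    by (intro poly_mapping_eqI)
      (auto simp: lookup_update lookup_add lookup_single when_def in_keys_iff)
  then show ?case using assms update by simp
qed (fact assms(1))

text \<open>Supports can shrink by cancellation, so additivity is computed over a common finite
  superset. Additivity in each factor then reduces products to monomials.\<close>

lemma class_ring_hom_eval_mpoly: "class_ring_hom (eval_mpoly (a :: 'n::finite \<Rightarrow> 'k::comm_ring_1))"
proof
  let ?M = "\<lambda>m. \<Prod>i\<in>UNIV. a i ^ Poly_Mapping.lookup m i"
  have sup: "eval_mpoly a f = (\<Sum>m\<in>A. Poly_Mapping.lookup f m * ?M m)"
    if "finite A" "Poly_Mapping.keys f \<subseteq> A" for f A
    unfolding eval_mpoly_def using that by (intro sum.mono_neutral_left) (auto simp: in_keys_iff)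
  have zero: "eval_mpoly a 0 = 0" by (simp add: eval_mpoly_def)
  have single: "eval_mpoly a (Poly_Mapping.single m c) = c * ?M m" for m c
    using sup[of "{m}" "Poly_Mapping.single m c"] by simp
  show add: "eval_mpoly a (f + g) = eval_mpoly a f + eval_mpoly a g" for f g
  proof -
    let ?A = "Poly_Mapping.keys f \<union> Poly_Mapping.keys g"
    have "Poly_Mapping.keys (f + g) \<subseteq> ?A" by (rule Poly_Mapping.keys_add)
    then show ?thesis
      by (simp add: sup[of ?A f] sup[of ?A g] sup[of ?A "f + g"] lookup_add distrib_right sum.distrib)
  qed
  have M_add: "?M (m + n) = ?M m * ?M n" for m n
    by (simp add: lookup_add power_add prod.distrib)
  show "eval_mpoly a (f * g) = eval_mpoly a f * eval_mpoly a g" for f g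
  proof (induction f rule: poly_mapping_additive_induct)
    case (single m c)
    show ?case
    proof (induction g rule: poly_mapping_additive_induct)
      case (single n d)
      then show ?case by (simp add: \<open>\<And>m c. eval_mpoly a (Poly_Mapping.single m c) = c * ?M m\<close> mult_single M_add mult_ac)
    qed (auto simp: zero add distrib_left)
  qed (auto simp: zero add distrib_right)
  show "eval_mpoly a 1 = 1" by (simp add: single flip: single_one)
qed

lemma eval_mpoly_Cst: "eval_mpoly a (Cst c) = c"
  by (simp add: eval_mpoly_def Cst_def)

lemma eval_mpoly_Var: "eval_mpoly a (Var i) = a i"
proof -
  have "(\<Prod>j\<in>UNIV. a j ^ Poly_Mapping.lookup (Poly_Mapping.single i 1) j) = (\<Prod>j\<in>UNIV. if j = i then a j else 1)"
    by (intro prod.cong) (auto simp: lookup_single)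
  then show ?thesis by (simp add: eval_mpoly_def Var_def)
qed

section \<open>Polynomials in a subset of the variables\<close>

text \<open>Given by generators and not by supports, so that facts about evaluation follow by rule
  induction.\<close>

inductive_set polys_in :: "'n set \<Rightarrow> ('n, 'k::comm_ring_1) mpoly set" for S where
  Cst: "Cst c \<in> polys_in S"
| Var: "i \<in> S \<Longrightarrow> Var i \<in> polys_in S"
| add: "f \<in> polys_in S \<Longrightarrow> g \<in> polys_in S \<Longrightarrow> f + g \<in> polys_in S"
| mult: "f \<in> polys_in S \<Longrightarrow> g \<in> polys_in S \<Longrightarrow> f * g \<in> polys_in S"

lemma Cst_simps:
  "Cst 0 = 0" "Cst 1 = 1" "Cst (c + d) = Cst c + Cst d" "Cst (c * d) = Cst c * Cst d" "Cst (- c) = - Cst c"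
  by (simp_all add: Cst_def single_add mult_single single_uminus)

lemma class_subring_polys_in: "class_subring (polys_in S)"
proof
  show "0 \<in> polys_in S" "1 \<in> polys_in S"
    using polys_in.Cst[of 0 S] polys_in.Cst[of 1 S] by (auto simp: Cst_simps)
  show "- f \<in> polys_in S" if "f \<in> polys_in S" for f :: "('a, 'b) mpoly"
    using polys_in.mult[OF polys_in.Cst[of "-1"] that] by (simp add: Cst_simps)
qed (auto intro: polys_in.intros)

lemma polys_in_UNIV: "f \<in> polys_in UNIV"
proof -
  interpret class_subring "polys_in UNIV :: ('a, 'b) mpoly set" by (rule class_subring_polys_in)
  have one: "Poly_Mapping.single m 1 \<in> (polys_in UNIV :: ('a, 'b) mpoly set)" for m
  proof (induction m rule: poly_mapping_additive_induct)
    case zero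
    then show ?case by (simp add: one_mem)
  next
    case (single i n)
    have "(Var i ^ n :: ('a, 'b) mpoly) = Poly_Mapping.single (Poly_Mapping.single i n) 1"
      by (induction n) (simp_all add: Var_def mult_single flip: single_add)
    then show ?case using power_mem[OF polys_in.Var[of i UNIV], of n] by simp
  next
    case (add m n)
    then show ?case using polys_in.mult[OF add] by (simp add: mult_single)
  qed
  show ?thesis
  proof (induction f rule: poly_mapping_additive_induct)
    case (single m c)
    then show ?case using polys_in.mult[OF polys_in.Cst[of c] one[of m]]
      by (simp add: Cst_def mult_single)
  qed (auto intro: zero_mem polys_in.add)
qed

lemma polys_in_empty: "f \<in> polys_in {} \<Longrightarrow> \<exists>c. f = Cst c"
  by (induction rule: polys_in.induct) (auto simp flip: Cst_simps)

lemma eval_mpoly_cong: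
  assumes "f \<in> polys_in S" "\<And>i. i \<in> S \<Longrightarrow> a i = b i"
  shows "eval_mpoly a f = eval_mpoly b f"
proof -
  interpret a: class_ring_hom "eval_mpoly a" by (rule class_ring_hom_eval_mpoly)
  interpret b: class_ring_hom "eval_mpoly b" by (rule class_ring_hom_eval_mpoly)
  show ?thesis using assms(1)
    by induction (auto simp: eval_mpoly_Cst eval_mpoly_Var a.hom_add b.hom_add a.hom_mult b.hom_mult assms(2))
qed

text \<open>Presents \<open>K[S, x]\<close> as \<open>K[S][x]\<close>, the form that
  \<open>extend_hom\<close> works with.\<close>

lemma polys_in_insert:
  assumes "f \<in> polys_in (insert x S)"
  shows "\<exists>p \<in> class_subring.polys (polys_in S). f = poly p (Var x)"
proof -
  interpret class_subring "polys_in S :: ('a, 'b) mpoly set" by (rule class_subring_polys_in)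
  have const: "\<exists>p\<in>polys. c = poly p (Var x)" if "c \<in> polys_in S" for c :: "('a, 'b) mpoly"
    using that by (intro bexI[of _ "[:c:]"]) (auto intro!: polys_intros)
  have var: "\<exists>p\<in>polys. (Var x :: ('a, 'b) mpoly) = poly p (Var x)"
    by (intro bexI[of _ "[:0, 1:]"]) (auto intro!: polys_intros zero_mem)
  show ?thesis using assms
  proof induction
    case (add f g)
    then show ?case by (metis poly_add polys_add)
  next
    case (mult f g)
    then show ?case by (metis poly_mult polys_mult)
  qed (auto intro: const var polys_in.intros)
qed

text \<open>The coefficients do not involve \<open>x\<close>, so changing that coordinate affects
  only \<open>Var x\<close>. This turns the \<open>t\<close> of \<open>extend_hom\<close> into a
  coordinate.\<close>

lemma eval_mpoly_poly_Var:
  assumes "p \<in> class_subring.polys (polys_in S)" "x \<notin> S"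
  shows "eval_mpoly (a(x := t)) (poly p (Var x)) = poly (map_poly (eval_mpoly a) p) t"
proof -
  interpret class_subring "polys_in S :: ('a, 'b) mpoly set" by (rule class_subring_polys_in)
  interpret a: class_ring_hom "eval_mpoly a" by (rule class_ring_hom_eval_mpoly)
  interpret b: class_ring_hom "eval_mpoly (a(x := t))" by (rule class_ring_hom_eval_mpoly)
  have "map_poly (eval_mpoly (a(x := t))) p = map_poly (eval_mpoly a) p"
    using assms polys_coeff
    by (intro poly_eqI) (auto simp: coeff_map_poly a.hom_zero b.hom_zero intro!: eval_mpoly_cong)
  then show ?thesis by (simp add: b.hom_poly eval_mpoly_Var)
qed

text \<open>Induction on \<open>S\<close> with \<open>s\<close> arbitrary, because the condition
  passed down is the \<open>r\<close> of \<open>extend_hom\<close>.\<close>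

lemma exists_zero_of_prime:
  fixes P :: "('n::finite, 'k::alg_closed_field) mpoly set"
  assumes P: "class_prime_ideal P" and "finite S" "s \<in> polys_in S" "s \<notin> P"
  shows "\<exists>a. (\<forall>f\<in>polys_in S \<inter> P. eval_mpoly a f = 0) \<and> eval_mpoly a s \<noteq> 0"
  using assms(2-)
proof (induction S arbitrary: s rule: finite_induct)
  case empty
  interpret P: class_prime_ideal P by fact
  obtain c where c: "s = Cst c" using empty polys_in_empty by blast
  have "c \<noteq> 0" using c empty P.zero_mem by (auto simp: Cst_simps)
  \<comment> \<open>A nonzero constant is a unit, so the prime ideal contains none.\<close>
  moreover have "f = 0" if f: "f \<in> polys_in {}" "f \<in> P" for f
  proof -
    obtain d where d: "f = Cst d" using f polys_in_empty by blast
    have "d = 0"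
    proof (rule ccontr)
      assume "d \<noteq> 0"
      then have "Cst d * Cst (inverse d) = (1 :: ('n, 'k) mpoly)" by (simp flip: Cst_simps)
      then show False using P.mult_mem[OF f(2), of "Cst (inverse d)"] d P.one_notin by simp
    qed
    then show ?thesis using d by (simp add: Cst_simps)
  qed
  ultimately show ?case using c by (auto simp: eval_mpoly_Cst intro!: eval_mpoly_Cst[of _ 0, unfolded Cst_simps])
next
  case (insert x S)
  interpret class_subring "polys_in S :: ('n, 'k) mpoly set" by (rule class_subring_polys_in)
  obtain p where p: "p \<in> polys" "s = poly p (Var x)" using polys_in_insert[OF insert.prems(1)] by blast
  have pP: "poly p (Var x) \<notin> P" using p insert.prems by simp
  \<comment> \<open>The bound \<open>p\<close> ranges over relations; the final \<open>p\<close> is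
    the fixed one that represents \<open>s\<close>.\<close>
  obtain r where r: "r \<in> polys_in S" "r \<notin> P" and
    ext: "\<And>\<phi> :: ('n, 'k) mpoly \<Rightarrow> 'k. class_ring_hom \<phi> \<Longrightarrow> \<forall>c\<in>polys_in S \<inter> P. \<phi> c = 0 \<Longrightarrow> \<phi> r \<noteq> 0 \<Longrightarrow>
      \<exists>t. (\<forall>p\<in>polys. poly p (Var x) \<in> P \<longrightarrow> poly (map_poly \<phi> p) t = 0) \<and> poly (map_poly \<phi> p) t \<noteq> 0"
  proof (rule extend_hom[OF P p(1) pP, where 'k = 'k], goal_cases)
    case (1 r)
    show ?case by (rule 1(1)[OF 1(2,3)]) (rule 1(4))
  qed
  obtain a where a: "\<forall>f\<in>polys_in S \<inter> P. eval_mpoly a f = 0" "eval_mpoly a r \<noteq> 0"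
    using insert.IH[OF r] by blast
  obtain t where t: "\<And>p. p \<in> polys \<Longrightarrow> poly p (Var x) \<in> P \<Longrightarrow> poly (map_poly (eval_mpoly a) p) t = 0"
    "poly (map_poly (eval_mpoly a) p) t \<noteq> 0"
    using ext[OF class_ring_hom_eval_mpoly a] by metis
  have "eval_mpoly (a(x := t)) f = 0" if f: "f \<in> polys_in (insert x S)" "f \<in> P" for f
  proof -
    obtain q where q: "q \<in> polys" "f = poly q (Var x)"
      using polys_in_insert[OF f(1)] by blast
    then show ?thesis using f t(1) eval_mpoly_poly_Var[OF q(1) insert.hyps(2)] by simp
  qed
  moreover have "eval_mpoly (a(x := t)) s \<noteq> 0"
    using p t(2) eval_mpoly_poly_Var[OF p(1) insert.hyps(2)] by simp
  ultimately show ?case by blast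
qed

section \<open>The Nullstellensatz\<close>

lemma mpoly_ring_simps:
  "carrier (mpoly_ring :: ('n, 'k::comm_ring_1) mpoly ring) = UNIV"
  "monoid.mult (mpoly_ring :: ('n, 'k) mpoly ring) = (*)"
  "monoid.one (mpoly_ring :: ('n, 'k) mpoly ring) = 1"
  "ring.zero (mpoly_ring :: ('n, 'k) mpoly ring) = 0"
  "ring.add (mpoly_ring :: ('n, 'k) mpoly ring) = (+)"
  by (simp_all add: ring_of_type_algebra_def)

lemma class_ideal_if_ideal:
  assumes "ideal I (mpoly_ring :: ('n, 'k::comm_ring_1) mpoly ring)"
  shows "class_ideal I"
proof -
  interpret ideal I mpoly_ring by fact
  show ?thesis
    using additive_subgroup.zero_closed[OF is_additive_subgroup]
      additive_subgroup.a_closed[OF is_additive_subgroup] I_r_closed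
    by unfold_locales (simp_all add: mpoly_ring_simps)
qed

lemma mpoly_ring_pow: "x [^]\<^bsub>mpoly_ring\<^esub> (n::nat) = (x :: ('n, 'k::comm_ring_1) mpoly) ^ n"
  by (induction n) (simp_all add: nat_pow_def mpoly_ring_simps mult.commute)

theorem nullstellensatz:
  fixes I :: "('n::finite, 'k::alg_closed_field) mpoly set"
  assumes "radical_ideal I mpoly_ring" and vanish: "\<And>a. a \<in> zero_locus I \<Longrightarrow> eval_mpoly a f = 0"
  shows "f \<in> I"
proof (rule ccontr)
  assume f: "f \<notin> I"
  have I: "class_ideal I" and rad: "ideal_radical mpoly_ring I = I"
    using assms class_ideal_if_ideal by (auto simp: radical_ideal_def)
  interpret class_ideal I by fact
  have "f ^ n \<notin> I" for n
  \<comment> \<open>\<open>ideal_radical\<close> speaks of positive exponents only; for exponent 0,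
    \<open>1 \<in> I\<close> would already give \<open>f \<in> I\<close>.\<close>
  proof (cases "n = 0")
    case True
    then show ?thesis using f mult_mem[of 1 f] by auto
  next
    case False
    have "f \<notin> ideal_radical mpoly_ring I" using f by (simp only: rad not_False_eq_True)
    then have "\<not> (\<exists>m>0. f ^ m \<in> I)"
      by (simp add: ideal_radical_def mpoly_ring_simps mpoly_ring_pow)
    then show ?thesis using False by blast
  qed
  then obtain P where P: "class_prime_ideal P" "I \<subseteq> P" "f \<notin> P"
    using exists_prime_ideal_avoiding_powers[OF I] by blast
  then obtain a where "\<forall>g\<in>P. eval_mpoly a g = 0" "eval_mpoly a f \<noteq> 0"
    using exists_zero_of_prime[OF P(1) finite_UNIV polys_in_UNIV P(3)] polys_in_UNIV by blast
  then show False using P(2) vanish[of a] by (auto simp: zero_locus_def)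
qed

section \<open>Separating points and the common eigenvectors\<close>

lemma separating_mpoly:
  fixes V :: "('n::finite \<Rightarrow> 'k::idom) set"
  assumes "finite V"
  obtains g where "eval_mpoly a g \<noteq> 0" "\<And>b. b \<in> V \<Longrightarrow> b \<noteq> a \<Longrightarrow> eval_mpoly b g = 0"
proof -
  \<comment> \<open>A coordinate in which \<open>b\<close> differs from \<open>a\<close>; its value
    at \<open>b = a\<close> is arbitrary, and the product leaves that point out.\<close>
  define i where "i b = (SOME i. b i \<noteq> a i)" for b
  have i: "b (i b) \<noteq> a (i b)" if "b \<noteq> a" for b
  proof -
    have "\<exists>j. b j \<noteq> a j" using that by blast
    then show ?thesis unfolding i_def by (rule someI_ex)
  qed
  define g where "g = (\<Prod>b\<in>V - {a}. Var (i b) - Cst (b (i b)))"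
  have ev: "eval_mpoly c g = (\<Prod>b\<in>V - {a}. c (i b) - b (i b))" for c
  proof -
    interpret class_ring_hom "eval_mpoly c" by (rule class_ring_hom_eval_mpoly)
    show ?thesis by (simp add: g_def hom_prod hom_diff eval_mpoly_Var eval_mpoly_Cst)
  qed
  show thesis
  proof
    show "eval_mpoly a g \<noteq> 0" using assms i by (force simp: ev)
    show "eval_mpoly b g = 0" if "b \<in> V" "b \<noteq> a" for b
      unfolding ev using that assms by (intro prod_zero) auto
  qed
qed

text \<open>There is one residue class per point: a nonzero common eigenvector determines its
  eigenvalues, so distinct points require different \<open>g j\<close>. An empty locus is the case
  \<open>r = 0\<close>.\<close>

theorem theorem2p13:
  fixes I :: "('n::finite, 'k::alg_closed_field) mpoly set"
  assumes "radical_ideal I mpoly_ring"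
    and "finite (zero_locus I)"
  shows "\<exists>(r::nat) (a :: nat \<Rightarrow> 'n \<Rightarrow> 'k) (g :: nat \<Rightarrow> ('n, 'k) mpoly set).
    inj_on a {1..r} \<and> zero_locus I = a ` {1..r} \<and>
    (\<forall>j\<in>{1..r}. g j \<in> carrier (quot_alg I) \<and> g j \<noteq> \<zero>\<^bsub>quot_alg I\<^esub> \<and>
      (\<forall>i. eigenvector (quot_alg I) (mult_op (quot_alg I) (residue I (Var i))) (g j) (a j i)))"
proof -
  interpret I: ideal I mpoly_ring using assms(1) by (simp add: radical_ideal_def)
  interpret h: ring_hom_ring mpoly_ring "mpoly_ring Quot I" "residue I"
    using I.rcos_ring_hom_ring by (simp add: residue_def[abs_def])
  interpret J: class_ideal I by (rule class_ideal_if_ideal) (rule I.is_ideal)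
  have carrier: "residue I f \<in> carrier (mpoly_ring Quot I)" for f
    by (rule h.hom_closed) (simp add: mpoly_ring_simps)
  have mult: "residue I f \<otimes>\<^bsub>mpoly_ring Quot I\<^esub> residue I g = residue I (f * g)" for f g
    using h.hom_mult[of f g] by (simp add: mpoly_ring_simps)
  have residue_eq: "residue I f = residue I g \<longleftrightarrow> f - g \<in> I" for f g
  proof -
    have "residue I f = residue I g \<longleftrightarrow> f \<ominus>\<^bsub>mpoly_ring\<^esub> g \<in> I"
      using I.quotient_eq_iff_same_a_r_cos[OF I.is_ideal, of f g] by (simp add: residue_def mpoly_ring_simps)
    moreover have "f \<ominus>\<^bsub>mpoly_ring\<^esub> g = f - g"
    proof -
      have "\<ominus>\<^bsub>mpoly_ring\<^esub> g = - g"
        by (rule I.minus_equality) (simp_all add: mpoly_ring_simps)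
      then show ?thesis by (simp add: a_minus_def mpoly_ring_simps)
    qed
    ultimately show ?thesis by simp
  qed
  have zero: "\<zero>\<^bsub>mpoly_ring Quot I\<^esub> = residue I 0"
    using h.hom_zero by (simp add: mpoly_ring_simps)
  obtain a :: "nat \<Rightarrow> 'n \<Rightarrow> 'k" where a: "bij_betw a {1..card (zero_locus I)} (zero_locus I)"
    using ex_bij_betw_nat_finite_1[OF assms(2)] by blast
  have "\<exists>g. eval_mpoly b g \<noteq> 0 \<and> (\<forall>c\<in>zero_locus I. c \<noteq> b \<longrightarrow> eval_mpoly c g = 0)" for b
    using separating_mpoly[OF assms(2)] by metis
  then obtain G where G: "\<And>b. eval_mpoly b (G b) \<noteq> 0"
    "\<And>b c. c \<in> zero_locus I \<Longrightarrow> c \<noteq> b \<Longrightarrow> eval_mpoly c (G b) = 0" by metis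
  have eig: "Var i * G b - Cst (b i) * G b \<in> I" for i b
  proof (rule nullstellensatz[OF assms(1)])
    fix c assume c: "c \<in> zero_locus I"
    interpret c: class_ring_hom "eval_mpoly c" by (rule class_ring_hom_eval_mpoly)
    have "eval_mpoly c (Var i * G b - Cst (b i) * G b) = (c i - b i) * eval_mpoly c (G b)"
      by (simp add: c.hom_diff c.hom_mult eval_mpoly_Var eval_mpoly_Cst left_diff_distrib)
    then show "eval_mpoly c (Var i * G b - Cst (b i) * G b) = 0"
      using G(2)[OF c, of b] by (cases "c = b") auto
  qed
  have nz: "G b \<notin> I" if "b \<in> zero_locus I" for b
    using that G(1)[of b] by (auto simp: zero_locus_def)
  have "residue I (G (a j)) \<noteq> \<zero>\<^bsub>mpoly_ring Quot I\<^esub>" if "j \<in> {1..card (zero_locus I)}" for j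
    using nz bij_betwE[OF a] that by (simp add: zero residue_eq)
  then show ?thesis
    using a carrier eig
    by (intro exI[of _ "card (zero_locus I)"] exI[of _ a] exI[of _ "\<lambda>j. residue I (G (a j))"])
      (auto simp: bij_betw_def eigenvector_def mult_op_def mult residue_eq)
qed

end
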